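(* Let $F$ be a graph with no isolated vertices and no isolated edge. Then for every $n\ge |F|$, \[ rssat(n,F)\ \ge\ \frac{\eta(F)}{2}\,n-\frac{\eta(F)^2-2\eta(F)+2}{2}. \] In particular, $rsat(n,F)\ge \frac{\eta(F)}{2}n-O(1)$, where the $O(1)$ term depends only on $F$.
   Context: All graphs are finite, simple, undirected and have nonempty vertex set. $|G|$ and $e(G)$ denote the number of vertices and edges of $G$; $N_F(u)$ is the neighborhood of $u$ in $F$. An isolated edge is a connected component isomorphic to $K_2$. For an ordered pair $(u,v)$ with $uv\in E(F)$ put $\omega(u,v)=2|N_F(u)\cap N_F(v)|+|N_F(v)\setminus N_F(u)|$. Define \[\omega^*(F)=\min_{uv\in E(F)}\max\{\omega(u,v),\omega(v,u)\},\quad \omega_*(F)=\min_{uv\in E(F)}\min\{\omega(u,v),\omega(v,u)\},\] and $\eta(F)=\max\{\omega^*(F)-1,\ \omega_*(F)\}$. An edge-colored graph is a pair $(G,\mathcal C)$ with $\mathcal C:E(G)\to\mathbb N$ an arbitrary map (not necessarily proper). A subgraph is rainbow if its edges have pairwise distinct colors. For a nonedge $e$ of $G$ and $\alpha\in\mathbb N$, $(G,\mathcal C)+_\alpha e$ is obtained by adding $e$ with color $\alpha$. $(G,\mathcal C)$ is $F$-rainbow-semisaturated if for every nonedge $e$ and every $\alpha\in\mathbb N$, $(G,\mathcal C)+_\alpha e$ contains a rainbow copy of $F$ (a not necessarily induced subgraph isomorphic to $F$) containing $e$; it is $F$-rainbow saturated if moreover $(G,\mathcal C)$ contains no rainbow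 copy of $F$. $rssat(n,F)$ (resp. $rsat(n,F)$) is the minimum of $e(G)$ over graphs $G$ with $|G|=n$ such that $(G,\mathcal C)$ is $F$-rainbow-semisaturated (resp. $F$-rainbow saturated) for some $\mathcal C$. *)

theory Defs
  imports Complex_Main
begin

record 'a graph =
  verts :: "'a set"
  edges :: "'a set set"

definition simple_graph :: "'a graph \<Rightarrow> bool" where
  "simple_graph G \<longleftrightarrow>
     finite (verts G) \<and> verts G \<noteq> {} \<and> (\<forall>e\<in>edges G. e \<subseteq> verts G \<and> card e = 2)"

definition nonedges :: "'a graph \<Rightarrow> 'a set set" where
  "nonedges G = {e. e \<subseteq> verts G \<and> card e = 2 \<and> e \<notin> edges G}"

definition add_edge :: "'a graph \<Rightarrow> 'a set \<Rightarrow> 'a graph" where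
  "add_edge G e = \<lparr>verts = verts G, edges = insert e (edges G)\<rparr>"

definition complete_graph :: "'a set \<Rightarrow> 'a graph" where
  "complete_graph V = \<lparr>verts = V, edges = {e. e \<subseteq> V \<and> card e = 2}\<rparr>"

definition subgraph :: "'a graph \<Rightarrow> 'a graph \<Rightarrow> bool" where
  "subgraph H G \<longleftrightarrow> simple_graph H \<and> verts H \<subseteq> verts G \<and> edges H \<subseteq> edges G"

definition induced_subgraph :: "'a graph \<Rightarrow> 'a set \<Rightarrow> 'a graph" where
  "induced_subgraph G W = \<lparr>verts = W, edges = {e \<in> edges G. e \<subseteq> W}\<rparr>"

definition isomorphic :: "'a graph \<Rightarrow> 'b graph \<Rightarrow> bool" where
  "isomorphic G H \<longleftrightarrow>
     (\<exists>f. bij_betw f (verts G) (verts H) \<and> (\<lambda>e. f ` e) ` edges G = edges H)"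

definition neighborhood :: "'a graph \<Rightarrow> 'a \<Rightarrow> 'a set" where
  "neighborhood G u = {v. {u, v} \<in> edges G}"

definition isolated_vertex :: "'a graph \<Rightarrow> 'a \<Rightarrow> bool" where
  "isolated_vertex G u \<longleftrightarrow> u \<in> verts G \<and> neighborhood G u = {}"

definition connected_component :: "'a graph \<Rightarrow> 'a graph \<Rightarrow> bool" where
  "connected_component G H \<longleftrightarrow>
     (\<exists>u\<in>verts G. H = induced_subgraph G {v. (u, v) \<in> {(x, y). {x, y} \<in> edges G}\<^sup>*})"

definition isolated_edge :: "'a graph \<Rightarrow> 'a graph \<Rightarrow> bool" where
  "isolated_edge G H \<longleftrightarrow>
     connected_component G H \<and> isomorphic H (complete_graph {..<2::nat})"

definition omega :: "'a graph \<Rightarrow> 'a \<Rightarrow> 'a \<Rightarrow> nat" where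
  "omega F u v =
     2 * card (neighborhood F u \<inter> neighborhood F v) + card (neighborhood F v - neighborhood F u)"

definition omega_upper :: "'a graph \<Rightarrow> nat" where
  "omega_upper F = Min {max (omega F u v) (omega F v u) | u v. {u, v} \<in> edges F}"

definition omega_lower :: "'a graph \<Rightarrow> nat" where
  "omega_lower F = Min {min (omega F u v) (omega F v u) | u v. {u, v} \<in> edges F}"

definition eta :: "'a graph \<Rightarrow> int" where
  "eta F = max (int (omega_upper F) - 1) (int (omega_lower F))"

text \<open>
  An edge-colored graph is given by a graph together with a total function on sets of vertices,
  of which only the values on the edges matter. Adding the nonedge \<open>e\<close> with color \<open>\<alpha>\<close> thus
  yields the pair \<open>add_edge G e\<close>, \<open>c(e := \<alpha>)\<close>.
\<close>

type_synonym 'a coloring = "'a set \<Rightarrow> nat"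

definition rainbow_copy :: "'b graph \<Rightarrow> 'a graph \<Rightarrow> 'a coloring \<Rightarrow> 'a graph \<Rightarrow> bool" where
  "rainbow_copy F G c H \<longleftrightarrow> subgraph H G \<and> isomorphic F H \<and> inj_on c (edges H)"

definition rainbow_semisaturated :: "'b graph \<Rightarrow> 'a graph \<Rightarrow> 'a coloring \<Rightarrow> bool" where
  "rainbow_semisaturated F G c \<longleftrightarrow>
     (\<forall>e\<in>nonedges G. \<forall>\<alpha>. \<exists>H. rainbow_copy F (add_edge G e) (c(e := \<alpha>)) H \<and> e \<in> edges H)"

definition rainbow_saturated :: "'b graph \<Rightarrow> 'a graph \<Rightarrow> 'a coloring \<Rightarrow> bool" where
  "rainbow_saturated F G c \<longleftrightarrow>
     rainbow_semisaturated F G c \<and> \<not> (\<exists>H. rainbow_copy F G c H)"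

text \<open>
  Every finite graph is isomorphic to one whose vertices are natural numbers, so the minima range
  over such graphs only. For \<open>n > 0\<close> they are attained: complete graphs are vacuously
  semisaturated, and a monochromatic one has no rainbow copy of an \<open>F\<close> with at least two edges.
\<close>

definition rssat :: "nat \<Rightarrow> 'b graph \<Rightarrow> nat" where
  "rssat n F = (LEAST m. \<exists>(G :: nat graph) c. simple_graph G \<and> card (verts G) = n \<and>
     card (edges G) = m \<and> rainbow_semisaturated F G c)"

definition rsat :: "nat \<Rightarrow> 'b graph \<Rightarrow> nat" where
  "rsat n F = (LEAST m. \<exists>(G :: nat graph) c. simple_graph G \<and> card (verts G) = n \<and>
     card (edges G) = m \<and> rainbow_saturated F G c)"

end

(* Let v be a vertex of minimum degree d in a semisaturated graph, and u a vertex not adjacent to v.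
   Adding uv completes a copy of F in which uv plays an edge xy.  As d(u) >= d(v), the degree of u is
   at least the larger degree of x and y, minus one; this gives
   d(u) + |N(u) \<inter> N(v)| >= omega^* - 1.  Giving uv the color of an edge at u (there is
   one, as xy is not an isolated edge of F) keeps that edge out of the copy, which saves one in the degree of u and gives
   d(u) + |N(u) \<inter> N(v)| >= omega_*.  Summing over all such u counts the edges between
   N(v) and the rest of the graph twice, so 2 e(G) >= eta (n - 1 - d) + 2 d.  This suffices when
   d < eta, and otherwise the degree sum does. *)
theory Submission
  imports Defs
begin

section \<open>Neighborhoods and degree counting\<close>

lemma simple_graph_edgeD:
  assumes "simple_graph G" "{u, v} \<in> edges G"
  shows "u \<in> verts G" "v \<in> verts G" "u \<noteq> v"
proof -
  have "{u, v} \<subseteq> verts G" "card {u, v} = 2" using assms unfolding simple_graph_def by blast+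
  then show "u \<in> verts G" "v \<in> verts G" "u \<noteq> v" by auto
qed

lemma simple_graph_edgeE:
  assumes "simple_graph G" "e \<in> edges G"
  obtains u v where "e = {u, v}" "u \<noteq> v"
proof -
  have "card e = 2" using assms unfolding simple_graph_def by blast
  then show thesis using that by (auto simp: card_2_iff)
qed

lemma finite_edges:
  assumes "simple_graph G"
  shows "finite (edges G)"
proof (rule finite_subset)
  show "edges G \<subseteq> Pow (verts G)" "finite (Pow (verts G))"
    using assms unfolding simple_graph_def by auto
qed

lemma neighborhood_iff: "v \<in> neighborhood G u \<longleftrightarrow> {u, v} \<in> edges G"
  by (simp add: neighborhood_def)

lemma neighborhood_sym: "v \<in> neighborhood G u \<longleftrightarrow> u \<in> neighborhood G v"
  by (simp add: neighborhood_def insert_commute)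

lemma neighborhood_subset: "simple_graph G \<Longrightarrow> neighborhood G u \<subseteq> verts G"
  by (auto simp: neighborhood_iff dest: simple_graph_edgeD)

lemma finite_neighborhood: "simple_graph G \<Longrightarrow> finite (neighborhood G u)"
  by (rule finite_subset[OF neighborhood_subset]) (auto simp: simple_graph_def)

lemma not_in_own_neighborhood: "simple_graph G \<Longrightarrow> u \<notin> neighborhood G u"
  using simple_graph_edgeD(3) neighborhood_iff by metis

text \<open>Double counting of incident pairs of a vertex and an edge; \<open>deg\<close> first
  turns the degree into the number of edges at \<open>u\<close>.\<close>

lemma sum_degrees:
  assumes "simple_graph G"
  shows "(\<Sum>u\<in>verts G. card (neighborhood G u)) = 2 * card (edges G)"
proof -
  have deg: "card (neighborhood G u) = card {e \<in> edges G. u \<in> e}" for u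
  proof (rule bij_betw_same_card)
    show "bij_betw (\<lambda>v. {u, v}) (neighborhood G u) {e \<in> edges G. u \<in> e}"
    proof (rule bij_betwI')
      fix e assume e: "e \<in> {e \<in> edges G. u \<in> e}"
      then obtain a b where "e = {a, b}" using assms by (blast elim: simple_graph_edgeE)
      with e show "\<exists>v\<in>neighborhood G u. e = {u, v}"
        by (auto simp: neighborhood_iff insert_commute)
    qed (auto simp: neighborhood_iff doubleton_eq_iff)
  qed
  have "(\<Sum>u\<in>verts G. card {e \<in> edges G. u \<in> e}) = 2 * card (edges G)"
  proof (rule sum_multicount)
    show "\<forall>e\<in>edges G. card {u \<in> verts G. u \<in> e} = 2"
    proof
      fix e assume "e \<in> edges G"
      then have "{u \<in> verts G. u \<in> e} = e" "card e = 2"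
        using assms unfolding simple_graph_def by auto
      then show "card {u \<in> verts G. u \<in> e} = 2" by simp
    qed
  qed (use assms finite_edges in \<open>auto simp: simple_graph_def\<close>)
  then show ?thesis by (simp add: deg)
qed

text \<open>The degree sum splits over \<open>v\<close>, its neighbors and \<open>U\<close>. The
  edges between \<open>U\<close> and the neighbors of \<open>v\<close> enter from both sides: in the
  degrees on \<open>U\<close>, and again as the common neighbor counts that bound the degrees of the
  neighbors of \<open>v\<close> from below.\<close>

lemma edges_ge_sum_nonneighbors:
  assumes G: "simple_graph G" and v: "v \<in> verts G"
  defines "U \<equiv> verts G - insert v (neighborhood G v)"
  shows "(\<Sum>u\<in>U. card (neighborhood G u) + card (neighborhood G u \<inter> neighborhood G v))
           + 2 * card (neighborhood G v) \<le> 2 * card (edges G)"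
proof -
  let ?N = "neighborhood G v"
  have fin: "finite U" "finite ?N"
    using finite_neighborhood[OF G] G unfolding U_def simple_graph_def by auto
  have split: "verts G = insert v (U \<union> ?N)" "v \<notin> U \<union> ?N" "U \<inter> ?N = {}"
    using v neighborhood_subset[OF G] not_in_own_neighborhood[OF G] unfolding U_def by auto
  \<comment> \<open>The summand 1 is the edge from \<open>w\<close> to \<open>v\<close>, since
    \<open>v\<close> lies outside \<open>U\<close>. Summed over all \<open>w\<close> these give the
    second \<open>card ?N\<close>; the first is the degree of \<open>v\<close> itself.\<close>
  have nb: "1 + card {u \<in> U. w \<in> neighborhood G u} \<le> card (neighborhood G w)" if "w \<in> ?N" for w
  proof -
    have "card (insert v {u \<in> U. w \<in> neighborhood G u}) \<le> card (neighborhood G w)"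
      using that by (intro card_mono finite_neighborhood G) (auto simp: neighborhood_sym)
    then show ?thesis
      using fin split by simp
  qed
  have "(\<Sum>u\<in>U. card (neighborhood G u \<inter> ?N)) = (\<Sum>u\<in>U. card {w \<in> ?N. w \<in> neighborhood G u})"
    by (intro sum.cong refl arg_cong[where f = card]) auto
  also have "\<dots> = (\<Sum>w\<in>?N. card {u \<in> U. w \<in> neighborhood G u})"
    using fin by (intro sum_multicount_gen) auto
  finally have "(\<Sum>u\<in>U. card (neighborhood G u \<inter> ?N)) + card ?N
      = (\<Sum>w\<in>?N. 1 + card {u \<in> U. w \<in> neighborhood G u})"
    by (simp add: sum_Suc)
  also have "\<dots> \<le> (\<Sum>w\<in>?N. card (neighborhood G w))"
    by (intro sum_mono nb)
  finally have "(\<Sum>u\<in>U. card (neighborhood G u \<inter> ?N)) + card ?N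
      \<le> (\<Sum>w\<in>?N. card (neighborhood G w))" .
  moreover have "2 * card (edges G) =
      card ?N + ((\<Sum>u\<in>U. card (neighborhood G u)) + (\<Sum>w\<in>?N. card (neighborhood G w)))"
    unfolding sum_degrees[OF G, symmetric] using fin split by (simp add: sum.union_disjoint)
  ultimately show ?thesis by (simp add: sum.distrib)
qed

section \<open>The parameters omega and eta, and isolated edges\<close>

text \<open>In this form, bounding omega amounts to bounding one degree and the number of common
  neighbors separately.\<close>

lemma omega_eq:
  assumes "simple_graph F"
  shows "omega F x y = card (neighborhood F x \<inter> neighborhood F y) + card (neighborhood F y)"
proof -
  have "card (neighborhood F y) =
      card (neighborhood F y \<inter> neighborhood F x) + card (neighborhood F y - neighborhood F x)"
    by (intro card_Int_Diff finite_neighborhood assms)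
  then show ?thesis by (simp add: omega_def Int_commute)
qed

lemma finite_edge_values:
  assumes "simple_graph F"
  shows "finite {g u v | u v. {u, v} \<in> edges F}"
proof (rule finite_subset)
  show "{g u v | u v. {u, v} \<in> edges F} \<subseteq> (\<lambda>(u, v). g u v) ` (verts F \<times> verts F)"
    using assms by (auto dest: simple_graph_edgeD)
qed (use assms in \<open>auto simp: simple_graph_def\<close>)

text \<open>Both minima are at most their values at any given edge. So to bound \<open>eta F\<close>
  from above it suffices to control the one edge of \<open>F\<close> whose role the added edge
  plays.\<close>

lemma eta_le:
  assumes "simple_graph F" "{x, y} \<in> edges F"
  shows "eta F \<le> max (int (max (omega F x y) (omega F y x)) - 1) (int (min (omega F x y) (omega F y x)))"
proof -
  have "omega_upper F \<le> max (omega F x y) (omega F y x)"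
    unfolding omega_upper_def using assms by (intro Min_le finite_edge_values) auto
  moreover have "omega_lower F \<le> min (omega F x y) (omega F y x)"
    unfolding omega_lower_def using assms by (intro Min_le finite_edge_values) auto
  ultimately show ?thesis unfolding eta_def by linarith
qed

text \<open>Each of \<open>x\<close> and \<open>y\<close> has the other as its only neighbor, so no
  walk from \<open>x\<close> leaves \<open>{x, y}\<close>, and this pair spans a component.\<close>

lemma isolated_edge_of_degrees:
  assumes F: "simple_graph F" and e: "{x, y} \<in> edges F"
    and deg: "card (neighborhood F x) \<le> 1" "card (neighborhood F y) \<le> 1"
  shows "\<exists>H. isolated_edge F H"
proof -
  let ?R = "{(a, b). {a, b} \<in> edges F}"
  note xy = simple_graph_edgeD[OF F e]
  have nb: "{x, z} \<in> edges F \<longleftrightarrow> z = y" "{y, z} \<in> edges F \<longleftrightarrow> z = x" for z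
    using deg e card_le_Suc0_iff_eq[OF finite_neighborhood[OF F]]
    by (auto simp: neighborhood_iff insert_commute)
  have "z \<in> {x, y}" if "(x, z) \<in> ?R\<^sup>*" for z
    using that by (induction rule: rtrancl_induct) (auto simp: nb)
  moreover have "(x, y) \<in> ?R\<^sup>*" using e by auto
  ultimately have comp: "{z. (x, z) \<in> ?R\<^sup>*} = {x, y}" by auto
  have edges: "{e \<in> edges F. e \<subseteq> {x, y}} = {{x, y}}"
  proof -
    have "e' = {x, y}" if e': "e' \<in> edges F" "e' \<subseteq> {x, y}" for e'
    proof -
      obtain a b where "e' = {a, b}" "a \<noteq> b" using e' F by (blast elim: simple_graph_edgeE)
      with e' show ?thesis by auto
    qed
    then show ?thesis using e by auto
  qed
  have pairs: "{e. e \<subseteq> {..<2::nat} \<and> card e = 2} = {{0, 1}}"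
  proof -
    have two: "{..<2::nat} = {0, 1}" by auto
    have "e \<subseteq> {0, 1} \<and> card e = 2 \<longleftrightarrow> e = {0, 1}" for e :: "nat set"
      using card_subset_eq[of "{0, 1::nat}" e] by auto
    then show ?thesis unfolding two by simp
  qed
  have "isomorphic (induced_subgraph F {x, y}) (complete_graph {..<2::nat})"
    unfolding isomorphic_def
  proof (intro exI conjI)
    let ?f = "\<lambda>z. if z = x then 0 else 1::nat"
    show "bij_betw ?f (verts (induced_subgraph F {x, y})) (verts (complete_graph {..<2}))"
      using xy(3) by (auto simp: induced_subgraph_def complete_graph_def bij_betw_def inj_on_def)
    show "(\<lambda>e. ?f ` e) ` edges (induced_subgraph F {x, y}) = edges (complete_graph {..<2})"
      using xy(3) by (auto simp: induced_subgraph_def complete_graph_def edges pairs)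
  qed
  moreover have "connected_component F (induced_subgraph F {x, y})"
    unfolding connected_component_def using xy(1) comp by metis
  ultimately show ?thesis unfolding isolated_edge_def by blast
qed

section \<open>Copies of F\<close>

text \<open>For the inclusion of the left side in the right, an edge of \<open>H\<close> at
  \<open>f x\<close> is the image of some \<open>{a, b}\<close>, and injectivity identifies
  \<open>x\<close> with \<open>a\<close> or \<open>b\<close>.\<close>

lemma neighborhood_image:
  assumes F: "simple_graph F" and x: "x \<in> verts F"
    and f: "inj_on f (verts F)" and H: "edges H = (\<lambda>e. f ` e) ` edges F"
  shows "neighborhood H (f x) = f ` neighborhood F x"
proof
  show "f ` neighborhood F x \<subseteq> neighborhood H (f x)"
  proof
    fix z assume "z \<in> f ` neighborhood F x"
    then obtain y where "{x, y} \<in> edges F" "{f x, z} = f ` {x, y}"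
      by (auto simp: neighborhood_iff)
    then show "z \<in> neighborhood H (f x)" unfolding neighborhood_iff H by blast
  qed
  show "neighborhood H (f x) \<subseteq> f ` neighborhood F x"
  proof
    fix z assume "z \<in> neighborhood H (f x)"
    then obtain e where e: "e \<in> edges F" "{f x, z} = f ` e"
      by (auto simp: neighborhood_iff H)
    then obtain a b where ab: "e = {a, b}" using F by (blast elim: simple_graph_edgeE)
    note v = simple_graph_edgeD[OF F e(1)[unfolded ab]]
    from e(2) ab have "f x = f a \<and> z = f b \<or> f x = f b \<and> z = f a"
      by (auto simp: doubleton_eq_iff)
    then have "x = a \<and> z = f b \<or> x = b \<and> z = f a"
      using inj_onD[OF f] x v by metis
    then show "z \<in> f ` neighborhood F x"
      using e(1) ab by (auto simp: neighborhood_iff insert_commute)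
  qed
qed

text \<open>The isomorphism may match the ends of the edge in either order; \<open>x\<close> and
  \<open>y\<close> are named so that \<open>x\<close> corresponds to \<open>v\<close> and
  \<open>y\<close> to \<open>u\<close>.\<close>

lemma isomorphic_edgeE:
  assumes F: "simple_graph F" and iso: "isomorphic F H" and e: "{u, v} \<in> edges H"
  obtains x y where "{x, y} \<in> edges F"
    "card (neighborhood H v) = card (neighborhood F x)"
    "card (neighborhood H u) = card (neighborhood F y)"
    "card (neighborhood H u \<inter> neighborhood H v) = card (neighborhood F x \<inter> neighborhood F y)"
proof -
  obtain f where f: "bij_betw f (verts F) (verts H)" "edges H = (\<lambda>e. f ` e) ` edges F"
    using iso unfolding isomorphic_def by metis
  then have inj: "inj_on f (verts F)" by (auto simp: bij_betw_def)
  obtain e' where e': "e' \<in> edges F" "{u, v} = f ` e'" using e f by auto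
  then obtain a b where "e' = {a, b}" using F by (blast elim: simple_graph_edgeE)
  with e' have "{a, b} \<in> edges F" "v = f a \<and> u = f b \<or> v = f b \<and> u = f a"
    by (auto simp: doubleton_eq_iff)
  then obtain x y where xy: "{x, y} \<in> edges F" "v = f x" "u = f y"
    by (metis insert_commute)
  note vs = simple_graph_edgeD[OF F xy(1)]
  have N: "neighborhood H v = f ` neighborhood F x" "neighborhood H u = f ` neighborhood F y"
    using neighborhood_image[OF F _ inj f(2)] xy vs by auto
  have sub: "neighborhood F x \<subseteq> verts F" "neighborhood F y \<subseteq> verts F"
    using neighborhood_subset[OF F] by auto
  have "neighborhood H u \<inter> neighborhood H v = f ` (neighborhood F x \<inter> neighborhood F y)"
    unfolding N using inj_on_image_Int[OF inj sub] by auto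
  moreover have "card (f ` A) = card A" if "A \<subseteq> verts F" for A
    using that inj by (intro card_image inj_on_subset[OF inj])
  ultimately show thesis using that[OF xy(1)] N sub by (simp add: le_infI1)
qed

section \<open>The local bound at a nonneighbor\<close>

lemma eta_le_nonneighbor:
  fixes F :: "'b graph" and G :: "'a graph"
  assumes F: "simple_graph F" and iso: "\<not> (\<exists>H. isolated_edge F H)"
    and G: "simple_graph G" and semi: "rainbow_semisaturated F G c"
    and u: "u \<in> verts G" and v: "v \<in> verts G" and uv: "u \<noteq> v" "{u, v} \<notin> edges G"
    and le: "card (neighborhood G v) \<le> card (neighborhood G u)"
  shows "eta F \<le> int (card (neighborhood G u) + card (neighborhood G u \<inter> neighborhood G v))"
proof -
  let ?N = "neighborhood G" and ?e = "{u, v}"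
  have nonedge: "?e \<in> nonedges G" using u v uv by (auto simp: nonedges_def)
  have vu: "v \<notin> ?N u" "u \<notin> ?N v" using uv by (auto simp: neighborhood_iff insert_commute)
  \<comment> \<open>The new edge raises the degrees of \<open>u\<close> and \<open>v\<close> by at
    most one and creates no common neighbor of the two. The color stays free, so that it can be
    chosen once an edge at \<open>u\<close> is known to exist.\<close>
  have copy: "\<exists>H x y. {x, y} \<in> edges F \<and> ?e \<in> edges H \<and> inj_on (c(?e := \<alpha>)) (edges H) \<and>
      neighborhood H u \<subseteq> insert v (?N u) \<and>
      card (neighborhood H u) = card (neighborhood F y) \<and>
      card (neighborhood F x) \<le> Suc (card (?N v)) \<and>
      card (neighborhood F y) \<le> Suc (card (?N u)) \<and>
      card (neighborhood F x \<inter> neighborhood F y) \<le> card (?N u \<inter> ?N v)" for \<alpha>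
  proof -
    obtain H where H: "rainbow_copy F (add_edge G ?e) (c(?e := \<alpha>)) H" "?e \<in> edges H"
      using semi nonedge unfolding rainbow_semisaturated_def by blast
    then have sg: "simple_graph H" and sub: "edges H \<subseteq> insert ?e (edges G)"
      and isoH: "isomorphic F H" and inj: "inj_on (c(?e := \<alpha>)) (edges H)"
      unfolding rainbow_copy_def subgraph_def add_edge_def by auto
    obtain x y where xy: "{x, y} \<in> edges F"
      "card (neighborhood H v) = card (neighborhood F x)"
      "card (neighborhood H u) = card (neighborhood F y)"
      "card (neighborhood H u \<inter> neighborhood H v) = card (neighborhood F x \<inter> neighborhood F y)"
      using isomorphic_edgeE[OF F isoH H(2)] by blast
    have Nu: "neighborhood H u \<subseteq> insert v (?N u)" and Nv: "neighborhood H v \<subseteq> insert u (?N v)"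
      using sub uv by (auto simp: neighborhood_iff doubleton_eq_iff)
    have "card (neighborhood H u) \<le> Suc (card (?N u))" "card (neighborhood H v) \<le> Suc (card (?N v))"
      using card_mono[OF _ Nu] card_mono[OF _ Nv] finite_neighborhood[OF G] vu by auto
    moreover have "card (neighborhood H u \<inter> neighborhood H v) \<le> card (?N u \<inter> ?N v)"
      using Nu Nv not_in_own_neighborhood[OF sg]
      by (intro card_mono finite_Int disjI1 finite_neighborhood[OF G]) auto
    ultimately show ?thesis using H(2) inj Nu xy by metis
  qed
  \<comment> \<open>If \<open>u\<close> had degree 0, so would \<open>v\<close> by
    \<open>le\<close>, and the added edge would play an edge of \<open>F\<close> whose ends both
    have degree at most 1, that is, an isolated edge.\<close>
  have pos: "?N u \<noteq> {}"
  proof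
    assume empty: "?N u = {}"
    with le have "card (?N u) = 0" "card (?N v) = 0" by auto
    with copy obtain x y where "{x, y} \<in> edges F"
      "card (neighborhood F x) \<le> 1" "card (neighborhood F y) \<le> 1"
      by (metis One_nat_def)
    then show False using isolated_edge_of_degrees[OF F] iso by blast
  qed
  then obtain w where w: "w \<in> ?N u" by blast
  obtain H x y where H: "{x, y} \<in> edges F" "?e \<in> edges H"
      "inj_on (c(?e := c {u, w})) (edges H)"
      "neighborhood H u \<subseteq> insert v (?N u)"
      "card (neighborhood H u) = card (neighborhood F y)"
      "card (neighborhood F x) \<le> Suc (card (?N v))"
      "card (neighborhood F y) \<le> Suc (card (?N u))"
      "card (neighborhood F x \<inter> neighborhood F y) \<le> card (?N u \<inter> ?N v)"
    using copy[of "c {u, w}"] by blast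
  have "w \<noteq> v" using w vu by blast
  then have ne: "{u, w} \<noteq> ?e" by (auto simp: doubleton_eq_iff)
  \<comment> \<open>The edge \<open>{u, w}\<close> keeps its color under the update and shares it
    with the added edge, so a rainbow copy containing the latter omits the former. The loss of
    \<open>w\<close> offsets the gain of \<open>v\<close> in the neighborhood of
    \<open>u\<close>.\<close>
  then have "{u, w} \<notin> edges H" using inj_onD[OF H(3), of "{u, w}" ?e] H(2) by auto
  then have "neighborhood H u \<subseteq> insert v (?N u) - {w}" using H(4) by (auto simp: neighborhood_iff)
  then have "card (neighborhood H u) \<le> card (insert v (?N u) - {w})"
    by (intro card_mono) (simp_all add: finite_neighborhood[OF G])
  also have "\<dots> = card (?N u)"
    using w vu finite_neighborhood[OF G] by simp
  finally have "card (neighborhood F y) \<le> card (?N u)" using H(5) by simp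
  moreover have "card (neighborhood F x) \<le> Suc (card (?N u))" using H(6) le by simp
  \<comment> \<open>This single copy serves both terms of \<open>eta\<close>: the first bound
    controls the smaller of the two omegas, and together they control the larger one up to the 1
    subtracted in \<open>eta\<close>.\<close>
  ultimately have "omega F x y \<le> card (?N u) + card (?N u \<inter> ?N v)"
    "omega F y x \<le> Suc (card (?N u) + card (?N u \<inter> ?N v))"
    using H(8) by (auto simp: omega_eq[OF F] Int_commute)
  then show ?thesis using eta_le[OF F H(1)] by linarith
qed

section \<open>The edge bound for semisaturated graphs\<close>

text \<open>The minimum \<open>omega_lower F\<close> is attained at some edge, and both ends of an
  edge have positive degree.\<close>

lemma eta_pos:
  assumes F: "simple_graph F" and "\<not> (\<exists>u. isolated_vertex F u)" "\<not> (\<exists>H. isolated_edge F H)"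
  shows "eta F \<ge> 1"
proof -
  let ?S = "{min (omega F u v) (omega F v u) | u v. {u, v} \<in> edges F}"
  obtain u where "u \<in> verts F" using F unfolding simple_graph_def by auto
  then obtain v where v: "{u, v} \<in> edges F"
    using assms(2) by (auto simp: isolated_vertex_def neighborhood_def)
  have "omega_lower F \<in> ?S"
    unfolding omega_lower_def using v F by (intro Min_in finite_edge_values) auto
  then obtain x y where xy: "{x, y} \<in> edges F" "omega_lower F = min (omega F x y) (omega F y x)"
    by auto
  then have "y \<in> neighborhood F x" "x \<in> neighborhood F y"
    by (auto simp: neighborhood_iff insert_commute)
  then have "card (neighborhood F x) > 0" "card (neighborhood F y) > 0"
    using finite_neighborhood[OF F] by (auto simp: card_gt_0_iff)
  with xy show ?thesis by (auto simp: eta_def omega_eq[OF F])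
qed

text \<open>The bound is doubled to stay within the integers. The proof compares the minimum degree
  with \<open>eta F\<close>.\<close>

lemma semisaturated_edges_ge:
  fixes F :: "'b graph" and G :: "'a graph"
  assumes F: "simple_graph F" "\<not> (\<exists>u. isolated_vertex F u)" "\<not> (\<exists>H. isolated_edge F H)"
    and G: "simple_graph G" and semi: "rainbow_semisaturated F G c"
  shows "eta F * int (card (verts G)) - ((eta F)\<^sup>2 - 2 * eta F + 2) \<le> 2 * int (card (edges G))"
proof -
  let ?d = "\<lambda>u. card (neighborhood G u)"
  have fin: "finite (verts G)" and ne: "verts G \<noteq> {}" using G unfolding simple_graph_def by auto
  obtain v where v: "v \<in> verts G" and min: "\<And>u. u \<in> verts G \<Longrightarrow> ?d v \<le> ?d u"
    using ex_min_if_finite[of "?d ` verts G"] fin ne by (auto simp: not_less)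
  have \<eta>: "eta F \<ge> 1" by (rule eta_pos[OF F])
  show ?thesis
  proof (cases "eta F \<le> int (?d v)")
    case True
    have "card (verts G) * ?d v \<le> 2 * card (edges G)"
      unfolding sum_degrees[OF G, symmetric]
      using sum_bounded_below[of "verts G" "?d v" ?d] min by simp
    then have "int (card (verts G)) * int (?d v) \<le> 2 * int (card (edges G))"
      by (metis of_nat_le_iff of_nat_mult of_nat_numeral)
    moreover have "eta F * int (card (verts G)) \<le> int (card (verts G)) * int (?d v)"
      using True by (simp add: mult.commute[of "eta F"] mult_left_mono)
    \<comment> \<open>The constant subtracted from \<open>eta F * n\<close> is positive, so a degree
      sum of at least \<open>eta F * n\<close> is enough.\<close>
    moreover have "(eta F)\<^sup>2 - 2 * eta F + 2 = (eta F - 1)\<^sup>2 + 1"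
      by (simp add: power2_eq_square algebra_simps)
    then have "(eta F)\<^sup>2 - 2 * eta F + 2 \<ge> 0" by (simp only:) simp
    ultimately show ?thesis by linarith
  next
    case False
    define U where "U = verts G - insert v (neighborhood G v)"
    have sub: "insert v (neighborhood G v) \<subseteq> verts G" using v neighborhood_subset[OF G] by auto
    have "card U + card (insert v (neighborhood G v)) = card (verts G)"
      unfolding U_def using card_Diff_subset[OF finite_subset[OF sub fin] sub] card_mono[OF fin sub]
      by simp
    then have cardU: "int (card U) = int (card (verts G)) - 1 - int (?d v)"
      using not_in_own_neighborhood[OF G] finite_neighborhood[OF G] by simp
    have "eta F \<le> int (?d u + card (neighborhood G u \<inter> neighborhood G v))" if "u \<in> U" for u
      using that v min
      by (intro eta_le_nonneighbor[OF F(1,3) G semi]) (auto simp: U_def neighborhood_iff insert_commute)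
    then have "int (card U) * eta F
        \<le> (\<Sum>u\<in>U. int (?d u + card (neighborhood G u \<inter> neighborhood G v)))"
      by (rule sum_bounded_below)
    also have "\<dots> = int (\<Sum>u\<in>U. ?d u + card (neighborhood G u \<inter> neighborhood G v))"
      by simp
    finally have *: "int (card U) * eta F + 2 * int (?d v) \<le> 2 * int (card (edges G))"
      using edges_ge_sum_nonneighbors[OF G v, folded U_def] by linarith
    \<comment> \<open>This product is exactly the surplus of the counted bound over the target. The
      second factor is nonnegative because the minimum degree is below \<open>eta F\<close>; the
      first is negative only for \<open>eta F = 1\<close>, where the minimum degree is 0 and the
      second factor vanishes.\<close>
    have "0 \<le> (eta F - 2) * (eta F - 1 - int (?d v))"
    proof (cases "eta F = 1")
      case True
      then show ?thesis using False by simp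
    next
      case False
      with \<eta> \<open>\<not> eta F \<le> int (?d v)\<close> show ?thesis by (intro mult_nonneg_nonneg) auto
    qed
    also have "\<dots> = int (card U) * eta F + 2 * int (?d v)
        - (eta F * int (card (verts G)) - ((eta F)\<^sup>2 - 2 * eta F + 2))"
      unfolding cardU by (simp add: algebra_simps power2_eq_square)
    finally show ?thesis using * by linarith
  qed
qed

section \<open>Existence of saturated colorings and the theorem\<close>

text \<open>If \<open>F\<close> had just one edge, all degrees would be at most 1 and that edge
  would be isolated. Two edges are what keeps a monochromatic graph free of rainbow copies.\<close>

lemma two_edges:
  assumes F: "simple_graph F" "\<not> (\<exists>u. isolated_vertex F u)" "\<not> (\<exists>H. isolated_edge F H)"
  shows "\<exists>e\<in>edges F. \<exists>e'\<in>edges F. e \<noteq> e'"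
proof (rule ccontr)
  assume "\<not> ?thesis"
  then have one: "e = e'" if "e \<in> edges F" "e' \<in> edges F" for e e'
    using that by blast
  obtain u where "u \<in> verts F" using F(1) unfolding simple_graph_def by auto
  then obtain v where v: "{u, v} \<in> edges F"
    using F(2) by (auto simp: isolated_vertex_def neighborhood_def)
  have "a = b" if "a \<in> neighborhood F x" "b \<in> neighborhood F x" for a b x
    using one[of "{x, a}" "{x, b}"] that by (auto simp: neighborhood_iff doubleton_eq_iff)
  then have "card (neighborhood F x) \<le> 1" for x
    using card_le_Suc0_iff_eq[OF finite_neighborhood[OF F(1)], of x] by auto
  then show False using isolated_edge_of_degrees[OF F(1) v] F(3) by blast
qed

text \<open>Semisaturation is vacuous without nonedges, and the two edges of \<open>F\<close> have
  distinct images of equal color in any copy.\<close>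

lemma complete_graph_rainbow_saturated:
  assumes F: "simple_graph F" and e: "e \<in> edges F" "e' \<in> edges F" "e \<noteq> e'"
  shows "rainbow_saturated F (complete_graph V) (\<lambda>_. \<alpha>)"
proof -
  have "\<not> rainbow_copy F (complete_graph V) (\<lambda>_. \<alpha>) H" for H
  proof
    assume "rainbow_copy F (complete_graph V) (\<lambda>_. \<alpha>) H"
    then obtain f where f: "inj_on f (verts F)" "edges H = (\<lambda>e. f ` e) ` edges F"
      and inj: "inj_on (\<lambda>_. \<alpha>) (edges H)"
      unfolding rainbow_copy_def isomorphic_def bij_betw_def by metis
    have "f ` e = f ` e'" by (rule inj_onD[OF inj refl]) (use e f(2) in auto)
    moreover have "e \<subseteq> verts F" "e' \<subseteq> verts F" using F e unfolding simple_graph_def by auto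
    ultimately show False using inj_on_image_eq_iff[OF f(1)] e(3) by blast
  qed
  moreover have "nonedges (complete_graph V) = {}"
    by (auto simp: nonedges_def complete_graph_def)
  ultimately show ?thesis by (simp add: rainbow_saturated_def rainbow_semisaturated_def)
qed

theorem theorem1p2:
  fixes F :: "'b graph"
  assumes "simple_graph F"
    and "\<not> (\<exists>u. isolated_vertex F u)"
    and "\<not> (\<exists>H. isolated_edge F H)"
  shows "(\<forall>n \<ge> card (verts F).
            real (rssat n F) \<ge> eta F / 2 * n - ((eta F)\<^sup>2 - 2 * eta F + 2) / 2) \<and>
         (\<exists>K :: real. \<forall>n \<ge> card (verts F). real (rsat n F) \<ge> eta F / 2 * n - K)"
proof -
  let ?C = "(eta F)\<^sup>2 - 2 * eta F + 2"
  have bound: "eta F / 2 * n - ?C / 2 \<le> real m"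
    if "simple_graph G" "card (verts G) = n" "card (edges G) = m" "rainbow_semisaturated F G c"
    for G :: "nat graph" and c n m
  proof -
    have "eta F * int n - ?C \<le> 2 * int m"
      using semisaturated_edges_ge[OF assms that(1,4)] that(2,3) by simp
    then have "real_of_int (eta F * int n - ?C) \<le> real_of_int (2 * int m)"
      by (simp only: of_int_le_iff)
    then show ?thesis by (simp add: field_simps)
  qed
  \<comment> \<open>Some graph must qualify for the \<open>LEAST\<close> in \<open>rsat\<close> and
    \<open>rssat\<close> to be attained; the monochromatic complete graph does. Its vertex set is
    nonempty because \<open>n\<close> is at least the order of \<open>F\<close>.\<close>
  have ex: "\<exists>m. \<exists>(G :: nat graph) c. simple_graph G \<and> card (verts G) = n \<and>
      card (edges G) = m \<and> rainbow_saturated F G c" if "n \<ge> card (verts F)" for n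
  proof -
    have "card (verts F) > 0" using assms(1) by (auto simp: simple_graph_def card_gt_0_iff)
    then have "simple_graph (complete_graph {..<n})" "card (verts (complete_graph {..<n})) = n"
      using that by (auto simp: simple_graph_def complete_graph_def lessThan_empty_iff)
    moreover obtain e e' where "e \<in> edges F" "e' \<in> edges F" "e \<noteq> e'"
      using two_edges[OF assms] by blast
    ultimately show ?thesis using complete_graph_rainbow_saturated[OF assms(1)] by blast
  qed
  have rssat: "eta F / 2 * n - ?C / 2 \<le> real (rssat n F)" if "n \<ge> card (verts F)" for n
  proof -
    have "\<exists>m. \<exists>(G :: nat graph) c. simple_graph G \<and> card (verts G) = n \<and>
        card (edges G) = m \<and> rainbow_semisaturated F G c"
      using ex[OF that] unfolding rainbow_saturated_def by blast
    from LeastI_ex[OF this] show ?thesis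
      unfolding rssat_def[symmetric] using bound by blast
  qed
  \<comment> \<open>Saturated graphs are semisaturated, so the same bound applies, and
    \<open>?C / 2\<close> serves as the constant \<open>K\<close>, which depends on \<open>F\<close>
    alone.\<close>
  have rsat: "eta F / 2 * n - ?C / 2 \<le> real (rsat n F)" if "n \<ge> card (verts F)" for n
    using LeastI_ex[OF ex[OF that]] bound
    unfolding rsat_def[symmetric] by (auto simp: rainbow_saturated_def)
  show ?thesis using rssat rsat by blast
qed

end
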